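(* Let $X$ be a real Banach space with the Krein--Milman property that satisfies the distance-to-denting property for relative Daugavet-points (for example, $X$ a space with the Radon--Nikod\'ym property). If $X$ contains a Daugavet-point relative to a supporting slice $S$ (i.e. there is $x\in S_X$ and a supporting slice $S$ at $x$ such that $x$ is a Daugavet-point relative to $S$), then $X$ contains a Daugavet-point relative to the same slice $S$ that is also an extreme point of $B_X$.
   Context: All Banach spaces are real. $B_X$ and $S_X$ denote the closed unit ball and unit sphere of $X$. A slice of $B_X$ is a set of the form $S(x^*,\alpha)=\{y\in B_X:\ x^*(y)>\sup x^*(B_X)-\alpha\}$ with $x^*\in X^*$ and $\alpha>0$. For $x\in S_X$ let $D(x)=\{x^*\in S_{X^*}:\ x^*(x)=1\}$; a supporting slice at $x$ is a slice $S(x^*,\alpha)$ with $x^*\in D(x)$ and $\alpha>0$. A point $x\in S_X$ is a Daugavet-point relative to a supporting slice $S$ at $x$ if $\sup_{y\in T}\|x-y\|=2$ for every slice $T$ of $B_X$ with $T\subseteq S$. A point of $B_X$ is a denting point of $B_X$ if it is contained in slices of $B_X$ of arbitrarily small diameter. $X$ has the Krein--Milman property (KMP) if every non-empty closed bounded convex subset of $X$ has an extreme point (equivalently, is the closed convex hull of its extreme points). $X$ satisfies the distance-to-denting property for relative Daugavet-points if for every $x\in S_X$ and every supporting slice $S=S(x^*,\alpha)$ at $x$, one has: $\|x-z\|=2$ for all denting points $z$ of $B_X$ in $S$ if and only if $x$ is a Daugavet-point relative to $S$. *)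

theory Defs
  imports "HOL-Analysis.Analysis"
begin

definition slice :: "('a::real_normed_vector \<Rightarrow>\<^sub>L real) \<Rightarrow> real \<Rightarrow> 'a set" where
  "slice f \<alpha> =
     {y \<in> cball 0 1. blinfun_apply f y > (SUP z\<in>cball 0 1. blinfun_apply f z) - \<alpha>}"

definition is_slice :: "'a::real_normed_vector set \<Rightarrow> bool" where
  "is_slice T \<longleftrightarrow> (\<exists>f \<alpha>. \<alpha> > 0 \<and> T = slice f \<alpha>)"

definition support_functionals :: "'a::real_normed_vector \<Rightarrow> ('a \<Rightarrow>\<^sub>L real) set" where
  "support_functionals x = {f \<in> sphere 0 1. blinfun_apply f x = 1}"

text \<open>Slices are sets, so being a supporting slice at \<open>x\<close> only asks for some representation
  by a functional supporting at \<open>x\<close>.\<close>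

definition is_supporting_slice :: "'a::real_normed_vector \<Rightarrow> 'a set \<Rightarrow> bool" where
  "is_supporting_slice x S \<longleftrightarrow> (\<exists>f\<in>support_functionals x. \<exists>\<alpha>>0. S = slice f \<alpha>)"

definition relative_daugavet_point :: "'a::real_normed_vector \<Rightarrow> 'a set \<Rightarrow> bool" where
  "relative_daugavet_point x S \<longleftrightarrow>
     x \<in> sphere 0 1 \<and> is_supporting_slice x S \<and>
     (\<forall>T. is_slice T \<and> T \<subseteq> S \<longrightarrow> (SUP y\<in>T. norm (x - y)) = 2)"

definition denting_point :: "'a::real_normed_vector \<Rightarrow> bool" where
  "denting_point z \<longleftrightarrow>
     z \<in> cball 0 1 \<and> (\<forall>\<epsilon>>0. \<exists>T. is_slice T \<and> z \<in> T \<and> diameter T < \<epsilon>)"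

definition krein_milman_property :: "'a::banach itself \<Rightarrow> bool" where
  "krein_milman_property _ \<longleftrightarrow>
     (\<forall>C::'a set. C \<noteq> {} \<and> closed C \<and> bounded C \<and> convex C \<longrightarrow> (\<exists>e. e extreme_point_of C))"

definition distance_to_denting_property :: "'a::banach itself \<Rightarrow> bool" where
  "distance_to_denting_property _ \<longleftrightarrow>
     (\<forall>x::'a. \<forall>S. x \<in> sphere 0 1 \<and> is_supporting_slice x S \<longrightarrow>
        ((\<forall>z. denting_point z \<and> z \<in> S \<longrightarrow> norm (x - z) = 2) \<longleftrightarrow> relative_daugavet_point x S))"

end

theory Submission
  imports Defs
begin

text \<open>Let \<open>x\<close> be a Daugavet-point relative to \<open>S = S(f, \<alpha>)\<close>, where \<open>f\<close> supports the unit ball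
  \<open>B\<close> at \<open>x\<close>. Let \<open>A\<close> be the set of all \<open>u \<in> B\<close> such that \<open>f u = 1\<close> and \<open>\<parallel>u - z\<parallel> = 2\<close> for every
  denting point \<open>z\<close> in \<open>S\<close>. The distance-to-denting property puts \<open>x\<close> in \<open>A\<close> and, read in the
  other direction, makes every point of \<open>A\<close> a Daugavet-point relative to the same slice \<open>S\<close>,
  because \<open>f u = 1\<close> says that \<open>f\<close> supports \<open>B\<close> at \<open>u\<close> as well. It is left to find an extreme
  point of \<open>B\<close> in \<open>A\<close>.

  Every condition that defines \<open>A\<close> says that a continuous convex function attains its upper
  bound on \<open>B\<close>. Hence \<open>A\<close> is closed, and a segment in \<open>B\<close> with a relative interior point in \<open>A\<close>
  has its end points in \<open>A\<close> (\<open>convex_on_open_segment_max\<close>). The set \<open>A\<close> need not be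
  convex, so the Krein--Milman property does not apply to it directly. With the Hahn--Banach
  theorem one would replace the norm conditions by linear ones, choosing for each \<open>z\<close> a functional
  that norms \<open>x - z\<close>. The proof below is more elementary: a maximal convex subset \<open>C\<close> of \<open>A\<close> that
  contains \<open>x\<close> is closed, and it is a face of \<open>B\<close> (\<open>maximal_convex_in_extremal_face_of\<close>). The
  Krein--Milman property gives an extreme point of \<open>C\<close>, which is then an extreme point of \<open>B\<close>.\<close>

text \<open>A smaller value at an end of the segment would pull the interior value below the bound,
  since the other end cannot exceed the bound to compensate.\<close>

lemma convex_on_open_segment_max:
  fixes \<phi> :: "'a::real_vector \<Rightarrow> real"
  assumes \<phi>: "convex_on B \<phi>" and le: "\<And>u. u \<in> B \<Longrightarrow> \<phi> u \<le> M"
    and ab: "a \<in> B" "b \<in> B" and c: "c \<in> open_segment a b" "\<phi> c = M"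
  shows "\<phi> a = M"
proof -
  obtain t where t: "0 < t" "t < 1" "c = (1 - t) *\<^sub>R a + t *\<^sub>R b"
    using c(1) by (auto simp: in_segment)
  have M: "M \<le> (1 - t) * \<phi> a + t * \<phi> b"
    using convex_onD[OF \<phi>, of t a b] t ab c(2) by simp
  moreover have "t * \<phi> b \<le> t * M"
    using le ab t by (intro mult_left_mono) auto
  ultimately have "(1 - t) * M \<le> (1 - t) * \<phi> a"
    by (simp add: algebra_simps)
  then have "M \<le> \<phi> a"
    using t by simp
  then show ?thesis
    using le[OF ab(1)] by simp
qed

lemma convex_Union_chain:
  fixes K :: "'a::real_vector set set"
  assumes chain: "\<And>C D. C \<in> K \<Longrightarrow> D \<in> K \<Longrightarrow> C \<subseteq> D \<or> D \<subseteq> C"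
    and convex: "\<And>C. C \<in> K \<Longrightarrow> convex C"
  shows "convex (\<Union>K)"
proof (rule convexI)
  fix a b :: 'a and u v :: real
  assume "a \<in> \<Union>K" "b \<in> \<Union>K" and uv: "0 \<le> u" "0 \<le> v" "u + v = 1"
  then obtain C where "C \<in> K" "a \<in> C" "b \<in> C"
    using chain by blast
  then show "u *\<^sub>R a + v *\<^sub>R b \<in> \<Union>K"
    using convexD[OF convex] uv by blast
qed

lemma exists_maximal_convex_subset:
  fixes A :: "'a::real_vector set"
  assumes "x \<in> A"
  obtains C where "convex C" "C \<subseteq> A" "x \<in> C"
    "\<And>D. convex D \<Longrightarrow> D \<subseteq> A \<Longrightarrow> C \<subseteq> D \<Longrightarrow> D = C"
proof -
  define \<K> where "\<K> = {C. convex C \<and> C \<subseteq> A \<and> x \<in> C}"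
  have "\<exists>C\<in>\<K>. \<forall>D\<in>\<K>. C \<subseteq> D \<longrightarrow> D = C"
  proof (rule subset_Zorn_nonempty)
    have "{x} \<in> \<K>"
      using assms by (simp add: \<K>_def)
    then show "\<K> \<noteq> {}"
      by blast
  next
    fix K assume "K \<noteq> {}" and K: "subset.chain \<K> K"
    have "convex (\<Union>K)"
      using K by (intro convex_Union_chain) (auto simp: subset_chain_def \<K>_def)
    then show "\<Union>K \<in> \<K>"
      using K \<open>K \<noteq> {}\<close> by (auto simp: subset_chain_def \<K>_def)
  qed
  then obtain C where "C \<in> \<K>" and max: "\<And>D. D \<in> \<K> \<Longrightarrow> C \<subseteq> D \<Longrightarrow> D = C"
    by blast
  then have C: "convex C" "C \<subseteq> A" "x \<in> C"
    by (auto simp: \<K>_def)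
  show ?thesis
  proof (rule that[OF C])
    fix D assume "convex D" "D \<subseteq> A" "C \<subseteq> D"
    then show "D = C"
      using max C(3) by (auto simp: \<K>_def)
  qed
qed

text \<open>If \<open>c \<in> C\<close> lies inside the segment from \<open>a\<close> to \<open>b\<close>, then for every \<open>d \<in> C\<close> and every point
  \<open>q\<close> between \<open>a\<close> and \<open>d\<close>, the segments from \<open>q\<close> to \<open>b\<close> and from \<open>c\<close> to \<open>d\<close>
  cross. The crossing point is in \<open>C \<subseteq> A\<close> by convexity, so extremality of \<open>A\<close> gives \<open>q \<in> A\<close>. Hence
  the convex hull of \<open>C\<close> and \<open>a\<close> stays inside \<open>A\<close>, and by maximality \<open>a \<in> C\<close>.\<close>

lemma maximal_convex_in_extremal_face_of:
  fixes A B C :: "'a::real_vector set"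
  assumes "convex B" and "A \<subseteq> B"
    and extremal: "\<And>a b c. a \<in> B \<Longrightarrow> b \<in> B \<Longrightarrow> c \<in> A \<Longrightarrow> c \<in> open_segment a b \<Longrightarrow> a \<in> A"
    and "convex C" and "C \<subseteq> A"
    and max: "\<And>D. convex D \<Longrightarrow> D \<subseteq> A \<Longrightarrow> C \<subseteq> D \<Longrightarrow> D = C"
  shows "C face_of B"
proof -
  have endpoint: "a \<in> C"
    if ab: "a \<in> B" "b \<in> B" and c: "c \<in> C" "c \<in> open_segment a b" for a b c
  proof -
    obtain t where t: "0 < t" "t < 1" "c = (1 - t) *\<^sub>R a + t *\<^sub>R b"
      using c(2) by (auto simp: in_segment)
    have between: "\<mu> *\<^sub>R a + (1 - \<mu>) *\<^sub>R d \<in> A"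
      if d: "d \<in> C" and \<mu>: "0 \<le> \<mu>" "\<mu> \<le> 1" for d \<mu>
    proof (cases "\<mu> = 0 \<or> \<mu> = 1")
      case True
      then show ?thesis
        using d c extremal[OF ab _ c(2)] \<open>C \<subseteq> A\<close> by auto
    next
      case False
      then have \<mu>: "0 < \<mu>" "\<mu> < 1"
        using \<mu> by auto
      define q where "q = \<mu> *\<^sub>R a + (1 - \<mu>) *\<^sub>R d"
      have q: "q \<in> B"
        unfolding q_def using \<mu> ab d \<open>convex B\<close> \<open>A \<subseteq> B\<close> \<open>C \<subseteq> A\<close> by (intro convexD) auto
      define N where "N = 1 - t + \<mu> * t"
      have N: "N > 0" "\<mu> < N"
      proof -
        show "N > 0"
          unfolding N_def using t \<mu> by (simp add: add_pos_pos)
        have "0 < (1 - t) * (1 - \<mu>)"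
          using t \<mu> by simp
        then show "\<mu> < N"
          by (simp add: N_def algebra_simps)
      qed
      \<comment> \<open>The weight \<open>s\<close> makes the coefficients of \<open>a\<close> and \<open>d\<close> in \<open>s c + (1 - s) d\<close>
          proportional to those in \<open>q\<close>; what remains is a multiple of \<open>b\<close>.\<close>
      define s where "s = \<mu> / N"
      have s: "0 < s" "s < 1"
        using N \<mu> by (auto simp: s_def)
      define w where "w = s *\<^sub>R c + (1 - s) *\<^sub>R d"
      have "w \<in> C"
        unfolding w_def using s c(1) d \<open>convex C\<close> by (intro convexD) auto
      have st: "0 < s * t" "s * t < 1"
        using s t mult_strict_mono[of s 1 t 1] by auto
      have coeff: "s * (1 - t) = (1 - s * t) * \<mu>"
        using N by (simp add: s_def N_def field_simps)
      then have "1 - s = (1 - s * t) * (1 - \<mu>)"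
        by (simp add: algebra_simps)
      then have w: "w = (1 - s * t) *\<^sub>R q + (s * t) *\<^sub>R b"
        using coeff by (simp add: w_def q_def t(3) scaleR_add_right add_ac)
      have "q \<in> A"
      proof (cases "q = b")
        case True
        then have "w = q"
          using w by (simp flip: scaleR_add_left)
        then show ?thesis
          using \<open>w \<in> C\<close> \<open>C \<subseteq> A\<close> by auto
      next
        case False
        then have "w \<in> open_segment q b"
          using w st by (auto simp: in_segment)
        then show ?thesis
          using extremal q ab(2) \<open>w \<in> C\<close> \<open>C \<subseteq> A\<close> by blast
      qed
      then show ?thesis
        by (simp add: q_def)
    qed
    have "convex hull (insert a C) \<subseteq> A"
    proof
      fix p assume "p \<in> convex hull (insert a C)"
      then obtain \<mu> \<nu> d where "0 \<le> \<mu>" "0 \<le> \<nu>" "\<mu> + \<nu> = 1" "d \<in> C" and p: "p = \<mu> *\<^sub>R a + \<nu> *\<^sub>R d"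
        using c(1) \<open>convex C\<close> by (subst (asm) convex_hull_insert) (auto simp: hull_same)
      moreover from this have "\<nu> = 1 - \<mu>"
        by simp
      ultimately show "p \<in> A"
        using between by simp
    qed
    moreover have "insert a C \<subseteq> convex hull (insert a C)"
      by (rule hull_subset)
    ultimately show "a \<in> C"
      using max[OF convex_convex_hull] by blast
  qed
  show ?thesis
    unfolding face_of_def
  proof (intro conjI ballI impI)
    show "C \<subseteq> B"
      using \<open>C \<subseteq> A\<close> \<open>A \<subseteq> B\<close> by (rule order_trans)
    show "convex C"
      by fact
    fix a b c assume "a \<in> B" "b \<in> B" "c \<in> C" "c \<in> open_segment a b"
    then show "a \<in> C" "b \<in> C"
      using endpoint[of a b c] endpoint[of b a c] open_segment_commute[of a b] by simp_all
  qed
qed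

text \<open>The Krein--Milman property reaches extremal sets that are not convex, through the closed faces
  inside them.\<close>

lemma closed_extremal_contains_extreme_point:
  fixes A B :: "'a::banach set"
  assumes kmp: "krein_milman_property TYPE('a)"
    and "convex B" and "bounded B" and "A \<subseteq> B" and "closed A" and "A \<noteq> {}"
    and extremal: "\<And>a b c. a \<in> B \<Longrightarrow> b \<in> B \<Longrightarrow> c \<in> A \<Longrightarrow> c \<in> open_segment a b \<Longrightarrow> a \<in> A"
  obtains e where "e \<in> A" "e extreme_point_of B"
proof -
  obtain x where "x \<in> A"
    using \<open>A \<noteq> {}\<close> by blast
  then obtain C where C: "convex C" "C \<subseteq> A" "x \<in> C"
    and max: "\<And>D. convex D \<Longrightarrow> D \<subseteq> A \<Longrightarrow> C \<subseteq> D \<Longrightarrow> D = C"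
    using exists_maximal_convex_subset by metis
  have face: "C face_of B"
    using maximal_convex_in_extremal_face_of[OF \<open>convex B\<close> \<open>A \<subseteq> B\<close> extremal C(1,2) max] .
  have "closure C = C"
    using C \<open>closed A\<close> by (intro max convex_closure closure_minimal closure_subset)
  then have "closed C"
    by (metis closed_closure)
  moreover have "bounded C"
    using \<open>bounded B\<close> C(2) \<open>A \<subseteq> B\<close> bounded_subset by blast
  ultimately obtain e where "e extreme_point_of C"
    using kmp C unfolding krein_milman_property_def by blast
  then have "e extreme_point_of B" "e \<in> C"
    using extreme_point_of_face[OF face] by auto
  then show ?thesis
    using that C(2) by auto
qed

theorem proposition3p23:
  fixes S :: "'a::banach set"
  assumes "krein_milman_property TYPE('a)"
    and "distance_to_denting_property TYPE('a)"
    and "\<exists>x. relative_daugavet_point x S"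
  shows "\<exists>y. relative_daugavet_point y S \<and> y extreme_point_of (cball 0 1)"
proof -
  have dist_iff: "(\<forall>z. denting_point z \<and> z \<in> S \<longrightarrow> norm (u - z) = 2) \<longleftrightarrow> relative_daugavet_point u S"
    if "u \<in> sphere 0 1" "is_supporting_slice u S" for u
    using assms(2) that unfolding distance_to_denting_property_def by blast
  obtain x where x: "relative_daugavet_point x S"
    using assms(3) by blast
  then have x_sphere: "x \<in> sphere 0 1" and x_slice: "is_supporting_slice x S"
    by (auto simp: relative_daugavet_point_def)
  then obtain f \<alpha> where f: "norm f = 1" "blinfun_apply f x = 1" and S: "\<alpha> > 0" "S = slice f \<alpha>"
    by (auto simp: is_supporting_slice_def support_functionals_def)
  define Z where "Z = {z. denting_point z \<and> z \<in> S}"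
  define A where "A = {u \<in> cball 0 1. blinfun_apply f u = 1 \<and> (\<forall>z\<in>Z. norm (u - z) = 2)}"
  have f_le: "blinfun_apply f u \<le> norm u" for u
    using norm_blinfun[of f u] f(1) by simp
  have dist_le: "norm (u - z) \<le> 2" if "u \<in> cball 0 1" "z \<in> Z" for u z
    using that norm_triangle_ineq4[of u z] by (auto simp: Z_def denting_point_def)
  have "x \<in> A"
    using x dist_iff[OF x_sphere x_slice] x_sphere f(2) by (auto simp: A_def Z_def)
  have "closed A"
  proof -
    have "A = cball 0 1 \<inter> {u. blinfun_apply f u = 1} \<inter> (\<Inter>z\<in>Z. {u. norm (u - z) = 2})"
      by (auto simp: A_def)
    then show ?thesis
      by (auto intro!: closed_Int closed_INT closed_Collect_eq continuous_intros)
  qed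
  have extremal: "a \<in> A"
    if ab: "a \<in> cball 0 1" "b \<in> cball 0 1" and c: "c \<in> A" "c \<in> open_segment a b" for a b c
  proof -
    have "convex_on (cball 0 1) (blinfun_apply f)"
      by (auto simp: convex_on_def blinfun.add_right blinfun.scaleR_right)
    then have "blinfun_apply f a = 1"
    proof (rule convex_on_open_segment_max[OF _ _ ab c(2)])
      show "blinfun_apply f u \<le> 1" if "u \<in> cball 0 1" for u
        using that f_le[of u] by simp
    qed (use c(1) in \<open>simp add: A_def\<close>)
    moreover have "norm (a - z) = 2" if "z \<in> Z" for z
    proof -
      have "convex_on (cball 0 1) (\<lambda>u. norm (u - z))"
        using convex_on_dist[of "cball 0 1" z] by (simp add: dist_norm norm_minus_commute)
      moreover have "norm (c - z) = 2"
        using c(1) \<open>z \<in> Z\<close> unfolding A_def by blast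
      ultimately show ?thesis
        using convex_on_open_segment_max[where \<phi> = "\<lambda>u. norm (u - z)", OF _ dist_le ab c(2)]
          \<open>z \<in> Z\<close> by blast
    qed
    ultimately show ?thesis
      using ab by (simp add: A_def)
  qed
  have "A \<subseteq> cball 0 1" "A \<noteq> {}"
    using \<open>x \<in> A\<close> by (auto simp: A_def)
  then obtain e where "e \<in> A" and extreme: "e extreme_point_of cball 0 1"
    by (rule closed_extremal_contains_extreme_point
          [OF assms(1) convex_cball bounded_cball _ \<open>closed A\<close>]) (erule (3) extremal)
  have "e \<in> sphere 0 1"
    using \<open>e \<in> A\<close> f_le[of e] by (auto simp: A_def)
  moreover have "is_supporting_slice e S"
    using \<open>e \<in> A\<close> f S by (auto simp: A_def is_supporting_slice_def support_functionals_def)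
  ultimately have "relative_daugavet_point e S"
    using dist_iff \<open>e \<in> A\<close> by (auto simp: A_def Z_def)
  then show ?thesis
    using extreme by blast
qed

end
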